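(* Let $M\in(\mathbb{Z}_{\ge0}\cup\{-\infty\})^{d\times m}$ and let $P=\mathrm{tconv}(M)$ be the corresponding tropical lattice polytope. Then, for every $i\in\{1,\dots,d\}$, $$\mathrm{tbvol}_i^-(P)\le\mathrm{tm}_i(M).$$
   Context: $\mathbb{T}=\mathbb{R}\cup\{-\infty\}$ with $x\oplus y=\max(x,y)$, $x\odot y=x+y$. For $V\subseteq\mathbb{T}^d$, $\mathrm{tconv}(V)=\{\bigoplus_{j=1}^n\lambda_j\odot v_j:\lambda_j\in\mathbb{T},\ \bigoplus_j\lambda_j=0,\ v_j\in V\}$; for a matrix $M$, $\mathrm{tconv}(M)$ is the tropical convex hull of its columns. A tropical polytope is $\mathrm{tconv}(V)$ for a finite set $V$; its vertices are the elements of its unique minimal generating set. Covector decomposition: let $v_1,\dots,v_n$ be the vertices of $P$, $v_j=(v_{1j},\dots,v_{dj})$, and put $v_{0j}=0$, $x_0=0$. For $G\subseteq\{0,\dots,d\}\times[n]$ let $C_G=\{x\in\mathbb{T}^d: v_{kj}+x_i\le v_{ij}+x_k\text{ for all }(i,j)\in G,\ k\in\{0,\dots,d\}\}$. The closed cells of the covector decomposition of $P$ are the nonempty $C_G$ for which every $i\in\{0,\dots,d\}$ occurs in some $(i,j)\in G$ and every $j\in[n]$ occurs in some $(i,j)\in G$ with $v_{ij}\ne-\infty$. Their union is $P$, and their images under $x\mapsto(b^{x_1},\dots,b^{x_d})$ ($b>1$, $b^{-\infty}=0$) are convex polytopes forming a polyhedral complex; the dimension of a cell is the dimension of its image. The $i$-trunk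 $\mathrm{Tr}_i(P)$ is the union of all closed cells of dimension at least $i$. Tropical lower barycentric $i$-volume: $\mathrm{tbvol}_i^-(P)=\max_{x\in\mathrm{Tr}_i(P)}\min\{\sum_{l\in I}x_l: I\subseteq[d],\ |I|=i\}$, with $\max\emptyset=-\infty$. Maximal tropical $i$-minor: $\mathrm{tm}_i(M)=\max\{\mathrm{tdet}(M_{I,J}):I\subseteq[d],\ J\subseteq[m],\ |I|=|J|=i\}$, where $M_{I,J}$ is the submatrix with rows $I$ and columns $J$ and $\mathrm{tdet}(A)=\max_{\sigma\in S_i}\sum_{l=1}^i a_{l\sigma(l)}$ for $A\in\mathbb{T}^{i\times i}$ (with $\max\emptyset=-\infty$ if $i>m$). *)

theory Defs
  imports "HOL-Analysis.Analysis"
begin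

text \<open>
  The tropical numbers are the elements of \<^typ>\<open>ereal\<close> different from \<open>\<infinity>\<close>; on these, \<open>max\<close> and \<open>+\<close>
  are the tropical operations. The supremum of the empty set in \<^typ>\<open>ereal\<close> is \<open>-\<infinity>\<close>, which is the
  convention for empty tropical sums and for the maximum of the empty set.
\<close>

definition trop_space :: "(ereal ^ 'd) set" where
  "trop_space = {x. \<forall>i. x $ i \<noteq> \<infinity>}"

definition tconv :: "(ereal ^ 'd) set \<Rightarrow> (ereal ^ 'd) set" where
  "tconv V = {x. \<exists>(n::nat) c v. (\<forall>j<n. c j \<noteq> \<infinity> \<and> v j \<in> V) \<and> (SUP j\<in>{..<n}. c j) = 0 \<and>
                  x = (\<chi> i. SUP j\<in>{..<n}. c j + v j $ i)}"

definition trop_vertices :: "(ereal ^ 'd) set \<Rightarrow> (ereal ^ 'd) set" where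
  "trop_vertices P =
     (THE V. V \<subseteq> trop_space \<and> tconv V = P \<and> (\<forall>W. W \<subset> V \<longrightarrow> tconv W \<noteq> P))"

text \<open>The index set \<open>{0,\<dots>,d}\<close> is \<^typ>\<open>'d option\<close>, with \<^term>\<open>None\<close> for the index \<open>0\<close>.\<close>

definition hcoord :: "ereal ^ 'd \<Rightarrow> 'd option \<Rightarrow> ereal" where
  "hcoord x k = (case k of None \<Rightarrow> 0 | Some i \<Rightarrow> x $ i)"

text \<open>Vertices serve as their own indices, so a covector graph is a set of pairs of a coordinate
  index and a vertex.\<close>

definition covector_cell :: "('d option \<times> (ereal ^ 'd)) set \<Rightarrow> (ereal ^ 'd) set" where
  "covector_cell G = {x \<in> trop_space.
     \<forall>(i, v) \<in> G. \<forall>k. hcoord v k + hcoord x i \<le> hcoord v i + hcoord x k}"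

definition covector_cells :: "(ereal ^ 'd) set \<Rightarrow> (ereal ^ 'd) set set" where
  "covector_cells P = {covector_cell G | G.
     G \<subseteq> UNIV \<times> trop_vertices P \<and>
     (\<forall>i. \<exists>v. (i, v) \<in> G) \<and>
     (\<forall>v \<in> trop_vertices P. \<exists>i. (i, v) \<in> G \<and> hcoord v i \<noteq> -\<infinity>) \<and>
     covector_cell G \<noteq> {}}"

definition trop_exp :: "real \<Rightarrow> ereal ^ 'd \<Rightarrow> real ^ 'd" where
  "trop_exp b x = (\<chi> i. if x $ i = -\<infinity> then 0 else b powr real_of_ereal (x $ i))"

definition cell_dim :: "real \<Rightarrow> (ereal ^ 'd) set \<Rightarrow> int" where
  "cell_dim b C = aff_dim (trop_exp b ` C)"

definition trunk :: "real \<Rightarrow> nat \<Rightarrow> (ereal ^ 'd) set \<Rightarrow> (ereal ^ 'd) set" where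
  "trunk b i P = \<Union> {C \<in> covector_cells P. int i \<le> cell_dim b C}"

text \<open>For a tropical polytope the trunk is a finite union of compact sets, so that the supremum below
  is attained unless the trunk is empty.\<close>

definition tbvol_lower :: "real \<Rightarrow> nat \<Rightarrow> (ereal ^ 'd) set \<Rightarrow> ereal" where
  "tbvol_lower b i P =
     (SUP x \<in> trunk b i P. Min {\<Sum>l\<in>I. x $ l | I :: 'd set. card I = i})"

definition tdet :: "nat \<Rightarrow> (nat \<Rightarrow> nat \<Rightarrow> ereal) \<Rightarrow> ereal" where
  "tdet n A = (MAX \<sigma> \<in> {\<sigma>. \<sigma> permutes {..<n}}. \<Sum>l<n. A l (\<sigma> l))"

text \<open>\<^const>\<open>from_nat_into\<close> enumerates a finite set \<open>I\<close> bijectively by \<open>{..<card I}\<close>. The choice of the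
  enumeration does not matter, as \<^const>\<open>tdet\<close> is invariant under permuting rows and columns.\<close>

definition submatrix :: "ereal ^ 'm ^ 'd \<Rightarrow> 'd set \<Rightarrow> 'm set \<Rightarrow> nat \<Rightarrow> nat \<Rightarrow> ereal" where
  "submatrix M I J = (\<lambda>k l. M $ from_nat_into I k $ from_nat_into J l)"

definition tminor :: "nat \<Rightarrow> ereal ^ 'm ^ 'd \<Rightarrow> ereal" where
  "tminor i M = Sup {tdet i (submatrix M I J) | I J. card I = i \<and> card J = i}"

end

theory Submission
  imports Defs
begin

text \<open>
  An edge \<open>(l, v)\<close> of a covector graph \<open>G\<close> forces \<open>x\<^sub>l \<le> v\<^sub>l\<close> on the cell of \<open>G\<close> (compare with the
  coordinate \<open>0\<close>), and two edges \<open>(l, v)\<close>, \<open>(l', v)\<close> at the same vertex force a linear relation between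
  the exponentials of \<open>x\<^sub>l\<close> and \<open>x\<^sub>l\<^sub>'\<close>. Choose an edge \<open>(k, j k)\<close> for every \<open>k\<close>. Then the cell has
  dimension at most the number of values of \<open>j\<close> different from \<open>j 0\<close>. So if the dimension is at
  least \<open>i\<close>, then representatives of \<open>i\<close> such values form a matching of \<open>i\<close> rows with \<open>i\<close> columns
  of \<open>M\<close>, whose weight dominates the sum of \<open>i\<close> coordinates of any point \<open>x\<close> of the cell.
\<close>

section \<open>Tropical convex hulls and their minimal generating sets\<close>

lemma hcoord_simps [simp]: "hcoord x None = 0" "hcoord x (Some i) = x $ i"
  by (simp_all add: hcoord_def)

lemma hcoord_not_PInf: "x \<in> trop_space \<Longrightarrow> hcoord x k \<noteq> \<infinity>"
  by (cases k) (auto simp: trop_space_def)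

lemma hcoord_eqI:
  assumes "\<And>k. hcoord x k = hcoord y k"
  shows "x = y"
  unfolding vec_eq_iff using assms[of "Some _"] by simp

text \<open>Tightness in the coordinate \<open>0\<close> means \<open>c = 0\<close>, so quantifying over all coordinates also covers the
  normalization of the coefficients in \<^const>\<open>tconv\<close>.\<close>

definition supports :: "'d option \<Rightarrow> ereal \<Rightarrow> ereal ^ 'd \<Rightarrow> ereal ^ 'd \<Rightarrow> bool" where
  "supports k c v x \<longleftrightarrow>
     c + hcoord v k = hcoord x k \<and> (\<forall>i. c + hcoord v i \<le> hcoord x i)"

lemma supports_le: "supports k c v x \<Longrightarrow> c + hcoord v i \<le> hcoord x i"
  by (simp add: supports_def)

lemma supports_nonpos: "supports k c v x \<Longrightarrow> c \<le> 0"
  using supports_le[of k c v x None] by simp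

lemma supports_refl: "supports k 0 x x"
  by (simp add: supports_def)

lemma supports_trans:
  assumes "supports k c v x" "supports k c' w v"
  shows "supports k (c + c') w x"
  using assms unfolding supports_def by (metis add.assoc add_left_mono order_trans)

text \<open>In a finite maximum each coordinate is attained by some term, and all terms stay below
  the maximum. Conversely, one supporting generator per coordinate rebuilds the point.\<close>

lemma mem_tconv_iff: "x \<in> tconv V \<longleftrightarrow> (\<forall>k. \<exists>v\<in>V. \<exists>c. supports k c v x)"
proof
  assume "x \<in> tconv V"
  then obtain n :: nat and c v where cv: "\<And>j. j < n \<Longrightarrow> v j \<in> V"
    and c0: "(SUP j\<in>{..<n}. c j) = 0" and x: "x = (\<chi> i. SUP j\<in>{..<n}. c j + v j $ i)"
    unfolding tconv_def by auto
  \<comment> \<open>The empty supremum is \<open>-\<infinity>\<close>, not \<open>0\<close>.\<close>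
  have n: "{..<n} \<noteq> {}"
    using c0 by (auto simp: bot_ereal_def)
  have eq: "hcoord x k = (SUP j\<in>{..<n}. c j + hcoord (v j) k)" for k
    by (cases k) (simp_all add: x c0)
  show "\<forall>k. \<exists>v\<in>V. \<exists>c. supports k c v x"
  proof
    fix k
    have "(SUP j\<in>{..<n}. c j + hcoord (v j) k) \<in> (\<lambda>j. c j + hcoord (v j) k) ` {..<n}"
      using n by (subst Max_Sup[symmetric]) (auto intro!: Max_in)
    then obtain j where "j < n" "c j + hcoord (v j) k = hcoord x k"
      by (auto simp: eq)
    then have "supports k (c j) (v j) x"
      by (auto simp: supports_def eq intro!: SUP_upper2[of j])
    then show "\<exists>v\<in>V. \<exists>c. supports k c v x"
      using cv \<open>j < n\<close> by blast
  qed
next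
  assume "\<forall>k. \<exists>v\<in>V. \<exists>c. supports k c v x"
  then obtain v c where vc: "\<And>k. v k \<in> V" "\<And>k. supports k (c k) (v k) x"
    by metis
  \<comment> \<open>\<open>tconv\<close> asks for families over an initial segment of the naturals,
    so the coordinates are enumerated.\<close>
  obtain h :: "nat \<Rightarrow> 'a option" where "bij_betw h {0..<CARD('a option)} UNIV"
    using ex_bij_betw_nat_finite[OF finite_class.finite_UNIV] by blast
  then have h: "h ` {..<CARD('a option)} = UNIV"
    by (simp add: bij_betw_def atLeast0LessThan)
  have eq: "(SUP j\<in>{..<CARD('a option)}. c (h j) + hcoord (v (h j)) k) = hcoord x k" for k
  proof -
    have "(SUP j\<in>{..<CARD('a option)}. c (h j) + hcoord (v (h j)) k) =
          (SUP l\<in>h ` {..<CARD('a option)}. c l + hcoord (v l) k)"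
      by (simp add: image_comp comp_def)
    also have "\<dots> = hcoord x k"
      unfolding h
    proof (rule antisym)
      show "(SUP l. c l + hcoord (v l) k) \<le> hcoord x k"
        by (rule SUP_least) (use vc(2) supports_le in blast)
      show "hcoord x k \<le> (SUP l. c l + hcoord (v l) k)"
        by (rule SUP_upper2[of k]) (use vc(2)[of k] in \<open>simp_all add: supports_def\<close>)
    qed
    finally show ?thesis .
  qed
  have "c k \<noteq> \<infinity>" for k
    using supports_nonpos[OF vc(2)[of k]] by auto
  then show "x \<in> tconv V"
    unfolding tconv_def using vc(1) eq[of None] eq[of "Some _"]
    by (intro CollectI exI[of _ "CARD('a option)"] exI[of _ "c \<circ> h"] exI[of _ "v \<circ> h"])
      (auto simp: vec_eq_iff)
qed

lemma subset_tconv: "V \<subseteq> tconv V"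
  using mem_tconv_iff supports_refl by blast

lemma tconv_subset:
  assumes "U \<subseteq> tconv W"
  shows "tconv U \<subseteq> tconv W"
proof
  fix x assume "x \<in> tconv U"
  then show "x \<in> tconv W"
    using assms unfolding mem_tconv_iff subset_iff by (meson supports_trans)
qed

lemma tconv_remove:
  assumes "w \<in> tconv (W - {w})"
  shows "tconv (W - {w}) = tconv W"
proof
  show "tconv (W - {w}) \<subseteq> tconv W"
    by (rule tconv_subset) (use subset_tconv in blast)
  show "tconv W \<subseteq> tconv (W - {w})"
    by (rule tconv_subset) (use assms subset_tconv[of "W - {w}"] in blast)
qed

text \<open>Writing \<open>w\<close> through \<open>U\<close>, and \<open>U\<close> through
  \<open>W\<close>, supports \<open>w\<close> by elements of \<open>W\<close>. Returning to
  \<open>w\<close> itself at a finite coordinate would force an element of \<open>U\<close> to equal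
  \<open>w\<close>; otherwise \<open>w\<close> is redundant in \<open>W\<close>.\<close>

lemma minimal_generators_subset:
  assumes W: "W \<subseteq> trop_space" and min: "\<And>W'. W' \<subset> W \<Longrightarrow> tconv W' \<noteq> tconv W"
    and U: "tconv U = tconv W"
  shows "W \<subseteq> U"
proof (rule subsetI, rule ccontr)
  fix w assume w: "w \<in> W" "w \<notin> U"
  have finite_coord: "\<exists>w'\<in>W - {w}. \<exists>c. supports k c w' w" if k: "hcoord w k \<noteq> -\<infinity>" for k
  proof -
    have "w \<in> tconv U"
      using w U subset_tconv by blast
    then obtain u c where u: "u \<in> U" "supports k c u w"
      unfolding mem_tconv_iff by blast
    then have "u \<in> tconv W"
      using U subset_tconv by blast
    then obtain w' c' where w': "w' \<in> W" "supports k c' w' u"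
      unfolding mem_tconv_iff by blast
    have *: "supports k (c + c') w' w"
      using u w' supports_trans by blast
    have "w' \<noteq> w"
    proof
      assume "w' = w"
      then have "(c + c') + hcoord w k = hcoord w k"
        using * by (simp add: supports_def)
      \<comment> \<open>Finiteness of the coordinate allows cancellation; as both coefficients are
        nonpositive, both vanish.\<close>
      then have "c + c' = 0"
        using k hcoord_not_PInf[of w k] w W
        by (cases "c + c'"; cases "hcoord w k") auto
      then have "c = 0" "c' = 0"
        using supports_nonpos[OF u(2)] supports_nonpos[OF w'(2)]
        by (cases c; cases c'; simp add: zero_ereal_def)+
      then have "hcoord u i \<le> hcoord w i" "hcoord w i \<le> hcoord u i" for i
        using supports_le[OF u(2)] supports_le[OF w'(2)] \<open>w' = w\<close> by auto
      then have "u = w"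
        by (intro hcoord_eqI antisym)
      then show False
        using u w by simp
    qed
    then show ?thesis
      using w' * by blast
  qed
  have "\<exists>w'\<in>W - {w}. \<exists>c. supports k c w' w" for k
  proof (cases "hcoord w k = -\<infinity>")
    case True
    \<comment> \<open>With coefficient \<open>-\<infinity>\<close> any generator supports a
      coordinate equal to \<open>-\<infinity>\<close>. Coordinate \<open>0\<close> is always finite
      and provides a generator other than \<open>w\<close>.\<close>
    obtain w' where w': "w' \<in> W - {w}"
      using finite_coord[of None] by auto
    then have inf: "- \<infinity> + hcoord w' i = - \<infinity>" for i
      using hcoord_not_PInf[of w' i] W by (cases "hcoord w' i") auto
    have "supports k (- \<infinity>) w' w"
      unfolding supports_def inf using True by simp
    then show ?thesis
      using w' by blast
  qed (rule finite_coord)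
  then have "w \<in> tconv (W - {w})"
    by (simp add: mem_tconv_iff)
  then show False
    using tconv_remove min[of "W - {w}"] w by blast
qed

text \<open>Finiteness gives a minimal generating subset of \<open>V\<close>, and
  \<open>minimal_generators_subset\<close> applied in both directions makes it unique, which settles
  the definite description.\<close>

lemma trop_vertices_subset:
  assumes V: "finite V" "V \<subseteq> trop_space"
  shows "trop_vertices (tconv V) \<subseteq> V"
proof -
  obtain W where W: "W \<subseteq> V" "tconv W = tconv V"
      and min: "\<And>W'. W' \<subseteq> V \<Longrightarrow> tconv W' = tconv V \<Longrightarrow> W' \<subseteq> W \<Longrightarrow> W' = W"
  proof -
    let ?A = "{W. W \<subseteq> V \<and> tconv W = tconv V}"
    have "finite ?A" "?A \<noteq> {}"
      using V by auto
    from finite_has_minimal[OF this]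
    obtain W where W: "W \<in> ?A" "\<forall>W'\<in>?A. W' \<subseteq> W \<longrightarrow> W = W'"
      by (rule bexE)
    show thesis
      by (rule that[of W]) (use W in auto)
  qed
  have "trop_vertices (tconv V) = W"
    unfolding trop_vertices_def
  proof (rule the_equality)
    show W': "W \<subseteq> trop_space \<and> tconv W = tconv V \<and> (\<forall>W'\<subset>W. tconv W' \<noteq> tconv V)"
      using W V min by (metis order_trans psubset_imp_subset psubset_eq)
    fix U assume "U \<subseteq> trop_space \<and> tconv U = tconv V \<and> (\<forall>W\<subset>U. tconv W \<noteq> tconv V)"
    then show "U = W"
      using minimal_generators_subset[of U W] minimal_generators_subset[of W U] W'
      by (metis subset_antisym)
  qed
  then show ?thesis
    using W by simp
qed

section \<open>Matchings and tropical minors\<close>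

text \<open>Enumerating rows and columns turns the matching into a permutation, whose sum is one
  term of the maximum.\<close>

lemma sum_matching_le_tdet:
  fixes M :: "ereal ^ 'm ^ 'd"
  assumes \<pi>: "bij_betw \<pi> I J"
  shows "(\<Sum>l\<in>I. M $ l $ \<pi> l) \<le> tdet (card I) (submatrix M I J)"
proof -
  let ?n = "card I" and ?f = "from_nat_into I" and ?g = "from_nat_into J"
  have f: "bij_betw ?f {..<?n} I"
    by (rule bij_betw_from_nat_into_finite) simp
  have g: "bij_betw ?g {..<?n} J"
    unfolding bij_betw_same_card[OF \<pi>] by (rule bij_betw_from_nat_into_finite) simp
  define \<tau> where "\<tau> = inv_into {..<?n} ?g \<circ> (\<pi> \<circ> ?f)"
  \<comment> \<open>\<open>permutes\<close> demands the identity outside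
    \<open>{..<card I}\<close>.\<close>
  define \<sigma> where "\<sigma> k = (if k < ?n then \<tau> k else k)" for k
  have "bij_betw \<tau> {..<?n} {..<?n}"
    unfolding \<tau>_def using bij_betw_trans[OF bij_betw_trans[OF f \<pi>] bij_betw_inv_into[OF g]] .
  then have "bij_betw \<sigma> {..<?n} {..<?n}"
    by (rule iffD1[OF bij_betw_cong, rotated]) (simp add: \<sigma>_def)
  then have \<sigma>: "\<sigma> permutes {..<?n}"
    by (rule bij_imp_permutes) (simp add: \<sigma>_def)
  have "(\<Sum>l\<in>I. M $ l $ \<pi> l) = (\<Sum>k<?n. M $ ?f k $ \<pi> (?f k))"
    using sum.reindex_bij_betw[OF f, of "\<lambda>l. M $ l $ \<pi> l"] by simp
  also have "\<dots> = (\<Sum>k<?n. submatrix M I J k (\<sigma> k))"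
  proof (rule sum.cong)
    fix k assume "k \<in> {..<?n}"
    then have "\<pi> (?f k) \<in> ?g ` {..<?n}"
      using f g \<pi> by (auto simp: bij_betw_def)
    then have "?g (\<sigma> k) = \<pi> (?f k)"
      using \<open>k \<in> {..<?n}\<close> by (simp add: \<sigma>_def \<tau>_def f_inv_into_f)
    then show "M $ ?f k $ \<pi> (?f k) = submatrix M I J k (\<sigma> k)"
      by (simp add: submatrix_def)
  qed simp
  also have "\<dots> \<le> tdet ?n (submatrix M I J)"
    unfolding tdet_def using \<sigma> by (intro Max_ge) (auto intro: finite_permutations)
  finally show ?thesis .
qed

lemma sum_matching_le_tminor:
  fixes M :: "ereal ^ 'm ^ 'd"
  assumes "bij_betw \<pi> I J"
  shows "(\<Sum>l\<in>I. M $ l $ \<pi> l) \<le> tminor (card I) M"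
  unfolding tminor_def
  using sum_matching_le_tdet[OF assms, of M] bij_betw_same_card[OF assms]
  by (intro Sup_upper2[of "tdet (card I) (submatrix M I J)"]) auto

section \<open>Dimension of covector cells\<close>

definition texp :: "real \<Rightarrow> ereal \<Rightarrow> real" where
  "texp b a = (if a = -\<infinity> then 0 else b powr real_of_ereal a)"

lemma trop_exp_nth: "trop_exp b x $ l = texp b (x $ l)"
  by (simp add: trop_exp_def texp_def)

lemma texp_add:
  assumes "a \<noteq> \<infinity>" "c \<noteq> \<infinity>"
  shows "texp b (a + c) = texp b a * texp b c"
  using assms by (cases a; cases c) (auto simp: texp_def powr_add)

lemma texp_0: "b > 1 \<Longrightarrow> texp b 0 = 1"
  by (simp add: texp_def)

lemma covector_cellD:
  "\<lbrakk>x \<in> covector_cell G; (l, v) \<in> G\<rbrakk> \<Longrightarrow> hcoord v k + hcoord x l \<le> hcoord v l + hcoord x k"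
  by (auto simp: covector_cell_def)

lemma covector_cell_le:
  "\<lbrakk>x \<in> covector_cell G; (Some l, v) \<in> G\<rbrakk> \<Longrightarrow> x $ l \<le> v $ l"
  using covector_cellD[of x G "Some l" v None] by simp

text \<open>Comparing each edge with the index of the other gives opposite inequalities;
  exponentiating makes the resulting equality linear in the exponentials of
  \<open>x\<close>.\<close>

lemma covector_cell_texp:
  assumes x: "x \<in> covector_cell G" and v: "v \<in> trop_space" "(k, v) \<in> G" "(l, v) \<in> G"
  shows "texp b (hcoord v k) * texp b (hcoord x l) = texp b (hcoord v l) * texp b (hcoord x k)"
proof -
  have "x \<in> trop_space"
    using x by (simp add: covector_cell_def)
  moreover have "hcoord v k + hcoord x l = hcoord v l + hcoord x k"
    using covector_cellD[OF x] v by (simp add: antisym)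
  ultimately show ?thesis
    using v by (metis texp_add hcoord_not_PInf)
qed

text \<open>Group the coordinates by their chosen vertex. On each group the exponentials of
  \<open>x\<close> are proportional to those of the vertex, which leaves one free factor per vertex;
  for \<open>j None\<close> the factor is \<open>1\<close> and contributes only a
  translation.\<close>

lemma cell_dim_le_card:
  fixes j :: "'d option \<Rightarrow> ereal ^ 'd"
  assumes b: "b > 1" and j: "\<And>k. (k, j k) \<in> G" "range j \<subseteq> trop_space"
  shows "cell_dim b (covector_cell G) \<le> int (card (range j - {j None}))"
proof -
  let ?S = "range j - {j None}"
  \<comment> \<open>The exponential of \<open>u\<close>, cut down to the group of coordinates that
    chose \<open>u\<close>.\<close>
  define B where "B u = (\<chi> l. if j (Some l) = u then texp b (u $ l) else 0)" for u
  have "trop_exp b ` covector_cell G \<subseteq> (+) (B (j None)) ` span (B ` ?S)"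
  proof (rule image_subsetI)
    fix x assume x: "x \<in> covector_cell G"
    \<comment> \<open>Where the chosen vertex is \<open>-\<infinity>\<close>, so is
      \<open>x\<close>. This covers groups without a finite entry, where the factor cannot be read
      off as a ratio.\<close>
    have zero: "texp b (x $ l) = 0" if "texp b (j (Some l) $ l) = 0" for l
      using that b covector_cell_le[OF x j(1), of l] by (auto simp: texp_def split: if_splits)
    have "\<exists>t. \<forall>l. j (Some l) = u \<longrightarrow> texp b (x $ l) = t * texp b (u $ l)" for u
    proof (cases "\<exists>k. j (Some k) = u \<and> texp b (u $ k) \<noteq> 0")
      case True
      then obtain k where k: "j (Some k) = u" "texp b (u $ k) \<noteq> 0"
        by blast
      have "texp b (x $ l) = texp b (x $ k) / texp b (u $ k) * texp b (u $ l)"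
        if "j (Some l) = u" for l
        using covector_cell_texp[OF x, of u "Some k" "Some l" b] j(1)[of "Some k"]
          j(1)[of "Some l"] j(2) that k
        by (auto simp: field_simps)
      then show ?thesis
        by blast
    next
      case False
      then show ?thesis
        using zero by (intro exI[of _ 0]) auto
    qed
    then obtain t where t: "\<And>l. texp b (x $ l) = t (j (Some l)) * texp b (j (Some l) $ l)"
      by metis
    \<comment> \<open>Index \<open>0\<close> belongs to this group and has exponential
      \<open>1\<close> in both vectors, which fixes the factor.\<close>
    have base: "texp b (x $ l) = texp b (j None $ l)" if "j (Some l) = j None" for l
      using covector_cell_texp[OF x, of "j None" None "Some l" b] j(1)[of None]
        j(1)[of "Some l"] j(2) that b
      by (auto simp: texp_0)
    have "trop_exp b x = B (j None) + (\<Sum>u\<in>?S. t u *\<^sub>R B u)"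
    proof (subst vec_eq_iff, rule allI)
      fix l
      have "(\<Sum>u\<in>?S. t u *\<^sub>R B u) $ l =
            (\<Sum>u\<in>?S. if j (Some l) = u then t u * texp b (u $ l) else 0)"
        unfolding sum_component by (rule sum.cong) (simp_all add: B_def)
      also have "\<dots> = (if j (Some l) = j None then 0 else texp b (x $ l))"
        using t[of l] by (subst sum.delta') auto
      finally show "trop_exp b x $ l = (B (j None) + (\<Sum>u\<in>?S. t u *\<^sub>R B u)) $ l"
        using base[of l] by (simp add: B_def trop_exp_nth)
    qed
    moreover have "(\<Sum>u\<in>?S. t u *\<^sub>R B u) \<in> span (B ` ?S)"
      by (intro span_sum span_scale span_base imageI)
    ultimately show "trop_exp b x \<in> (+) (B (j None)) ` span (B ` ?S)"
      by blast
  qed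
  then have "cell_dim b (covector_cell G) \<le> aff_dim ((+) (B (j None)) ` span (B ` ?S))"
    unfolding cell_dim_def by (rule aff_dim_subset)
  also have "\<dots> = int (dim (B ` ?S))"
    by (simp only: aff_dim_translation_eq aff_dim_subspace[OF subspace_span] dim_span)
  also have "dim (B ` ?S) \<le> card ?S"
    by (meson card_image_le dim_le_card' finite finite_Diff finite_imageI order_trans)
  finally show ?thesis
    by simp
qed

theorem theorem5p12:
  fixes M :: "ereal ^ 'm ^ 'd" and b :: real and i :: nat
  assumes "\<forall>r c. M $ r $ c = -\<infinity> \<or> (\<exists>n::nat. M $ r $ c = ereal (real n))"
    and "b > 1"
    and "1 \<le> i" and "i \<le> CARD('d)"
  shows "tbvol_lower b i (tconv (columns M)) \<le> tminor i M"
  unfolding tbvol_lower_def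
proof (rule SUP_least)
  fix x assume "x \<in> trunk b i (tconv (columns M))"
  then obtain G where G: "G \<subseteq> UNIV \<times> trop_vertices (tconv (columns M))"
      "\<forall>k. \<exists>v. (k, v) \<in> G"
    and dim: "int i \<le> cell_dim b (covector_cell G)" and x: "x \<in> covector_cell G"
    unfolding trunk_def covector_cells_def by blast
  have entries: "M $ r $ c \<noteq> \<infinity>" for r c
    using assms(1)[rule_format, of r c] by auto
  have columns: "columns M \<subseteq> trop_space"
    using entries by (auto simp: columns_def column_def trop_space_def)
  have "finite (columns M)"
    by (simp add: columns_def full_SetCompr_eq)
  \<comment> \<open>The vertices are columns of \<open>M\<close>, so every chosen edge points to a
    column.\<close>
  from trop_vertices_subset[OF this columns] G
  obtain j where j: "\<And>k. (k, j k) \<in> G" "range j \<subseteq> columns M"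
    by (metis image_subsetI mem_Sigma_iff subset_eq)
  have "i \<le> card (range j - {j None})"
    using dim cell_dim_le_card[OF assms(2) j(1)] j(2) columns by fastforce
  then obtain S where S: "S \<subseteq> range j - {j None}" "card S = i"
    by (meson obtain_subset_with_card_n)
  \<comment> \<open>A value other than \<open>j None\<close> is chosen at some index
    \<open>Some l\<close>, whose \<open>l\<close> serves as its row.\<close>
  have "\<exists>l. j (Some l) = u" if "u \<in> S" for u
    using S(1) that by (metis DiffE imageE not_None_eq singletonI subsetD)
  then obtain r where r: "\<And>u. u \<in> S \<Longrightarrow> j (Some (r u)) = u"
    by metis
  have "\<exists>c. column c M = u" if "u \<in> S" for u
  proof -
    have "u \<in> columns M"
      using S(1) j(2) that by blast
    then show ?thesis
      by (auto simp: columns_def)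
  qed
  then obtain col where col: "\<And>u. u \<in> S \<Longrightarrow> column (col u) M = u"
    by metis
  let ?I = "r ` S" and ?\<pi> = "\<lambda>l. col (j (Some l))"
  have inj: "inj_on r S"
    by (metis inj_onI r)
  then have card: "card ?I = i"
    using S by (simp add: card_image)
  \<comment> \<open>A column index determines its vertex, and hence the row picked for that
    vertex.\<close>
  have "inj_on ?\<pi> ?I"
    by (rule inj_onI) (use r col in \<open>metis imageE\<close>)
  then have \<pi>: "bij_betw ?\<pi> ?I (?\<pi> ` ?I)"
    by (simp add: bij_betw_def)
  \<comment> \<open>The minimum runs over all \<open>i\<close>-subsets of coordinates, so the
    matched rows bound it.\<close>
  have "Min {\<Sum>l\<in>I. x $ l |I. card I = i} \<le> (\<Sum>l\<in>?I. x $ l)"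
    using card by (intro Min_le) auto
  also have "\<dots> \<le> (\<Sum>l\<in>?I. M $ l $ ?\<pi> l)"
  proof (rule sum_mono)
    fix l assume "l \<in> ?I"
    then obtain u where u: "u \<in> S" "l = r u"
      by blast
    have "x $ l \<le> u $ l"
      using covector_cell_le[OF x j(1)[of "Some l"]] u r by simp
    also have "u $ l = M $ l $ ?\<pi> l"
      using u r col by (metis column_def vec_lambda_beta)
    finally show "x $ l \<le> M $ l $ ?\<pi> l" .
  qed
  also have "\<dots> \<le> tminor i M"
    using sum_matching_le_tminor[OF \<pi>, of M] card by simp
  finally show "Min {\<Sum>l\<in>I. x $ l |I. card I = i} \<le> tminor i M" .
qed

end
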